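(* There exists a submodule $M\subset \mathbb{C}[x,y]$ such that $x\in \operatorname{cl} M$ but $x\notin M$.
   Context: A submodule of $\mathbb{C}[x,y]$ is a translation invariant linear subspace of $\mathbb{C}[x,y]$; equivalently, a linear subspace closed under the partial derivatives $\partial/\partial x$ and $\partial/\partial y$. $\mathbb{C}[x,y]$ is equipped with the topology of uniform convergence on compact subsets of $\mathbb{C}^2$, and $\operatorname{cl} M$ denotes the closure of $M$ in $\mathbb{C}[x,y]$ with respect to this topology. Here $x$ denotes the polynomial $(x,y)\mapsto x$. *)

theory Defs
  imports "HOL-Analysis.Analysis" "HOL-Computational_Algebra.Polynomial"
    "HOL-Library.Function_Algebras"
begin

(* As the complex numbers form an infinite field, elements of C[x,y] are identified with
   polynomial functions. In p :: complex poly poly the outer variable is y, the inner one x. *)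
definition polys2 :: "(complex \<times> complex \<Rightarrow> complex) set"
  where "polys2 = range (\<lambda>(p :: complex poly poly) (x, y). poly (poly p [:y:]) x)"

definition scale_fun :: "complex \<Rightarrow> (complex \<times> complex \<Rightarrow> complex) \<Rightarrow> complex \<times> complex \<Rightarrow> complex"
  where "scale_fun c f = (\<lambda>z. c * f z)"

interpretation scale_fun: vector_space scale_fun
  by unfold_locales (auto simp: scale_fun_def fun_eq_iff algebra_simps)

definition submodule :: "(complex \<times> complex \<Rightarrow> complex) set \<Rightarrow> bool"
  where "submodule M \<longleftrightarrow> M \<subseteq> polys2 \<and> scale_fun.subspace M \<and>
    (\<forall>f\<in>M. \<forall>w. (\<lambda>z. f (z + w)) \<in> M)"

(* The basic neighbourhoods of f are the polynomials uniformly e-close to f on a compact K. *)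
definition compact_conv_topology :: "(complex \<times> complex \<Rightarrow> complex) topology"
  where "compact_conv_topology = topology (\<lambda>U. U \<subseteq> polys2 \<and>
    (\<forall>f\<in>U. \<exists>K e. compact K \<and> e > 0 \<and>
      {g \<in> polys2. \<forall>z\<in>K. dist (g z) (f z) < e} \<subseteq> U))"

lemma openin_compact_conv_topology:
  "openin compact_conv_topology U \<longleftrightarrow> U \<subseteq> polys2 \<and>
    (\<forall>f\<in>U. \<exists>K e. compact K \<and> e > 0 \<and>
      {g \<in> polys2. \<forall>z\<in>K. dist (g z) (f z) < e} \<subseteq> U)"
proof -
  let ?B = "\<lambda>K e f. {g \<in> polys2. \<forall>z\<in>K. dist (g z) (f z) < (e::real)}"
  let ?P = "\<lambda>U. U \<subseteq> polys2 \<and> (\<forall>f\<in>U. \<exists>K e. compact K \<and> e > 0 \<and> ?B K e f \<subseteq> U)"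
  have Int: "?P (S \<inter> T)" if S: "?P S" and T: "?P T" for S T
  proof (intro conjI ballI)
    show "S \<inter> T \<subseteq> polys2" using S by blast
    fix f assume f: "f \<in> S \<inter> T"
    obtain K d where K: "compact K" "d > 0" "?B K d f \<subseteq> S" using S f by (meson IntD1)
    obtain L e where L: "compact L" "e > 0" "?B L e f \<subseteq> T" using T f by (meson IntD2)
    have "?B (K \<union> L) (min d e) f \<subseteq> ?B K d f \<inter> ?B L e f" by auto
    also have "\<dots> \<subseteq> S \<inter> T" using K(3) L(3) by (rule Int_mono)
    finally have "?B (K \<union> L) (min d e) f \<subseteq> S \<inter> T" .
    moreover have "compact (K \<union> L)" "min d e > 0" using K L by (auto intro: compact_Un)
    ultimately show "\<exists>K e. compact K \<and> e > 0 \<and> ?B K e f \<subseteq> S \<inter> T" by meson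
  qed
  have Un: "?P (\<Union>\<U>)" if U: "\<forall>S\<in>\<U>. ?P S" for \<U>
  proof (intro conjI ballI)
    show "\<Union>\<U> \<subseteq> polys2" using U by (meson Sup_least)
    fix f assume "f \<in> \<Union>\<U>"
    then obtain S where S: "S \<in> \<U>" "f \<in> S" by (rule UnionE)
    then obtain K e where K: "compact K" "e > 0" "?B K e f \<subseteq> S" using U by meson
    have "?B K e f \<subseteq> \<Union>\<U>" using K(3) S(1) by (rule subset_trans[OF _ Union_upper])
    with K(1,2) show "\<exists>K e. compact K \<and> e > 0 \<and> ?B K e f \<subseteq> \<Union>\<U>" by meson
  qed
  have "istopology ?P"
    unfolding istopology_def by (rule conjI; intro allI impI) (rule Int Un; assumption)+
  then show ?thesis unfolding compact_conv_topology_def by (subst topology_inverse') auto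
qed

lemma topspace_compact_conv_topology: "topspace compact_conv_topology = polys2"
proof -
  have "openin compact_conv_topology polys2"
    unfolding openin_compact_conv_topology
    by (intro conjI ballI exI[of _ "{}"] exI[of _ 1]) auto
  moreover have "topspace compact_conv_topology \<subseteq> polys2"
    using openin_topspace openin_compact_conv_topology by (meson order_refl)
  ultimately show ?thesis by (meson openin_subset subset_antisym)
qed

end

theory Submission
  imports Defs "HOL-Computational_Algebra.Formal_Power_Series"
begin

text \<open>
  For a formal power series \<open>\<phi>(T) = (\<Sum>n. a\<^sub>n T\<^sup>n)\<close> with \<open>a\<^sub>0 = 0\<close>, the polynomial solutions \<open>f\<close> of
  \<open>\<partial>f/\<partial>x = \<phi>(\<partial>/\<partial>y) f\<close> form a submodule \<open>M\<close>, and \<open>x\<close> is not a solution. A solution is determined by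
  its restriction to the line \<open>x = 0\<close>, and the solution that restricts to \<open>y\<^sup>n/n!\<close> is the coefficient
  \<open>e\<^sub>n\<close> of \<open>T\<^sup>n\<close> in \<open>exp (y T + x \<phi>(T))\<close>. So \<open>M\<close> is the linear span of the \<open>e\<^sub>n\<close>, and the two
  properties of \<open>M\<close> can be read off from this series:

  \<^item> The exponent is additive in \<open>(x, y)\<close>, so the \<open>e\<^sub>n\<close> satisfy the convolution identity
    \<open>translation_formula\<close>, which makes their span translation invariant.

  \<^item> A combination of the \<open>e\<^sub>n\<close> that vanishes for \<open>x = 0\<close> is zero, hence \<open>x\<close> is not in \<open>M\<close>
    (\<open>fst_notin_span_binomial_seq\<close>).

  It remains to choose \<open>\<phi>\<close> such that \<open>x\<close> is a limit of elements of \<open>M\<close>. For \<open>n \<ge> 1\<close>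
  the coefficient \<open>a\<^sub>n\<close> enters \<open>e\<^sub>n\<close> only through the summand \<open>a\<^sub>n x\<close>, as \<open>e\<^sub>n = a\<^sub>n x + g\<^sub>n\<close> with a
  polynomial \<open>g\<^sub>n\<close> that depends only on the earlier coefficients. One can therefore choose the \<open>a\<^sub>n\<close>
  one after the other, each so large that \<open>g\<^sub>n/a\<^sub>n\<close> is at most \<open>1/n\<close> on the ball of radius \<open>n - 1\<close>
  (\<open>fast_coefficients\<close>). Then \<open>e\<^sub>n/a\<^sub>n\<close> converges to \<open>x\<close> uniformly on compact sets.
\<close>

section \<open>Polynomial functions of two variables\<close>

lemma polys2_const: "(\<lambda>z. c) \<in> polys2"
  unfolding polys2_def by (rule range_eqI[of _ _ "[:[:c:]:]"]) auto

lemma polys2_fst: "fst \<in> polys2"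
  unfolding polys2_def by (rule range_eqI[of _ _ "[:[:0, 1:]:]"]) auto

lemma polys2_snd: "snd \<in> polys2"
  unfolding polys2_def by (rule range_eqI[of _ _ "[:0, 1:]"]) auto

lemma polys2_add:
  assumes "f \<in> polys2" "g \<in> polys2"
  shows "(\<lambda>z. f z + g z) \<in> polys2"
proof -
  obtain p q where "f = (\<lambda>(x, y). poly (poly p [:y:]) x)" "g = (\<lambda>(x, y). poly (poly q [:y:]) x)"
    using assms unfolding polys2_def by auto
  then show ?thesis
    unfolding polys2_def by (intro range_eqI[of _ _ "p + q"]) auto
qed

lemma polys2_mult:
  assumes "f \<in> polys2" "g \<in> polys2"
  shows "(\<lambda>z. f z * g z) \<in> polys2"
proof -
  obtain p q where "f = (\<lambda>(x, y). poly (poly p [:y:]) x)" "g = (\<lambda>(x, y). poly (poly q [:y:]) x)"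
    using assms unfolding polys2_def by auto
  then show ?thesis
    unfolding polys2_def by (intro range_eqI[of _ _ "p * q"]) auto
qed

lemma polys2_sum:
  assumes "\<And>i. i \<in> I \<Longrightarrow> f i \<in> polys2"
  shows "(\<lambda>z. \<Sum>i\<in>I. f i z) \<in> polys2"
  using assms
  by (induction I rule: infinite_finite_induct) (auto intro: polys2_const polys2_add)

lemma subspace_polys2: "scale_fun.subspace polys2"
  unfolding scale_fun.subspace_def scale_fun_def plus_fun_def zero_fun_def
  by (auto intro: polys2_const polys2_add polys2_mult)

section \<open>The polynomials generated by an exponential\<close>

text \<open>
  The coefficients of the \<open>T\<close>-derivative of the exponent \<open>y T + x \<phi>(T)\<close>, where \<open>\<phi>\<close> is the power series
  with \<open>\<phi>(0) = 0\<close> and derivative \<open>(\<Sum>k. c\<^sub>k T\<^sup>k)\<close>.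
\<close>

definition exponent_deriv :: "(nat \<Rightarrow> complex) \<Rightarrow> nat \<Rightarrow> complex \<times> complex \<Rightarrow> complex"
  where "exponent_deriv c k z = (if k = 0 then snd z else 0) + c k * fst z"

text \<open>
  The coefficients \<open>e\<^sub>n\<close> of \<open>E = exp (y T + x \<phi>(T))\<close>, computed by comparing coefficients in the
  differential equation \<open>E' = (y + x \<phi>'(T)) E\<close>. The recursion shows directly that they are polynomials
  and on which coefficients of \<open>\<phi>\<close> they depend.
\<close>

fun binomial_seq :: "(nat \<Rightarrow> complex) \<Rightarrow> nat \<Rightarrow> complex \<times> complex \<Rightarrow> complex" where
  "binomial_seq c 0 z = 1"
| "binomial_seq c (Suc n) z =
    (\<Sum>k\<le>n. exponent_deriv c k z * binomial_seq c (n - k) z) / of_nat (Suc n)"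

lemma binomial_seq_polys2: "binomial_seq c n \<in> polys2"
proof (induction n rule: less_induct)
  case (less n)
  show ?case
  proof (cases n)
    case 0
    have "binomial_seq c 0 = (\<lambda>z. 1)" by (simp add: fun_eq_iff)
    then show ?thesis using 0 polys2_const by simp
  next
    case (Suc m)
    have "exponent_deriv c k \<in> polys2" for k
      unfolding exponent_deriv_def
      by (cases "k = 0") (auto intro!: polys2_add polys2_mult polys2_const polys2_fst polys2_snd)
    then have "(\<lambda>z. (\<Sum>k\<le>m. exponent_deriv c k z * binomial_seq c (m - k) z)
        * (1 / of_nat (Suc m))) \<in> polys2"
      using less Suc by (intro polys2_mult[OF polys2_sum polys2_const] polys2_mult) auto
    then show ?thesis unfolding Suc by (simp add: binomial_seq.simps[abs_def])
  qed
qed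

lemma continuous_on_binomial_seq: "continuous_on A (binomial_seq c n)"
proof (induction n rule: less_induct)
  case (less n)
  have "continuous_on A (exponent_deriv c k)" for k
    unfolding exponent_deriv_def by (cases "k = 0") (auto intro!: continuous_intros)
  then show ?case using less
    by (cases n) (auto simp: binomial_seq.simps[abs_def] simp del: of_nat_Suc
      intro!: continuous_intros)
qed

lemma binomial_seq_axis: "binomial_seq c n (0, y) = y ^ n / fact n"
proof (induction n)
  case (Suc n)
  have "(\<Sum>k\<le>n. exponent_deriv c k (0, y) * binomial_seq c (n - k) (0, y))
      = (\<Sum>k\<le>n. if k = 0 then y * binomial_seq c n (0, y) else 0)"
    by (intro sum.cong) (auto simp: exponent_deriv_def)
  also have "\<dots> = y ^ Suc n / fact n" using Suc by simp
  finally show ?case by (simp add: mult.commute del: of_nat_Suc)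
qed simp

lemma binomial_seq_cong:
  assumes "\<And>k. k < n \<Longrightarrow> c k = d k"
  shows "binomial_seq c n z = binomial_seq d n z"
  using assms
proof (induction n rule: less_induct)
  case (less n)
  then show ?case
    by (cases n) (auto simp: exponent_deriv_def intro!: sum.cong)
qed

text \<open>
  Only the summand \<open>k = n\<close> of the recursion contains the coefficient \<open>c\<^sub>n\<close>, and there
  it is multiplied by \<open>x e\<^sub>0 = x\<close>.
\<close>

lemma binomial_seq_top_coefficient:
  "binomial_seq c (Suc n) z
     = c n * fst z / of_nat (Suc n) + binomial_seq (c(n := 0)) (Suc n) z"
proof -
  have "(\<Sum>k<n. exponent_deriv c k z * binomial_seq c (n - k) z)
      = (\<Sum>k<n. exponent_deriv (c(n := 0)) k z * binomial_seq (c(n := 0)) (n - k) z)"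
    by (intro sum.cong arg_cong2[of _ _ _ _ "(*)"] binomial_seq_cong) (auto simp: exponent_deriv_def)
  then show ?thesis
    by (simp add: lessThan_Suc_atMost[symmetric] exponent_deriv_def add_divide_distrib)
qed

unbundle no vec_syntax
unbundle fps_syntax

text \<open>
  The differential equation expresses each coefficient of a solution in terms of the previous ones.
\<close>

lemma fps_linear_ode_unique:
  fixes F G H :: "'a :: field_char_0 fps"
  assumes F: "fps_deriv F = H * F" and G: "fps_deriv G = H * G" and init: "F $ 0 = G $ 0"
  shows "F = G"
proof (rule fps_ext)
  fix n show "F $ n = G $ n"
  proof (induction n rule: less_induct)
    case (less n)
    show ?case
    proof (cases n)
      case 0
      then show ?thesis using init by simp
    next
      case (Suc m)
      have "of_nat (Suc m) * F $ Suc m = (\<Sum>i=0..m. H $ i * F $ (m - i))"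
        using arg_cong[OF F, of "\<lambda>A. A $ m"] by (simp add: fps_mult_nth)
      also have "\<dots> = (\<Sum>i=0..m. H $ i * G $ (m - i))"
        using less Suc by (intro sum.cong) auto
      also have "\<dots> = of_nat (Suc m) * G $ Suc m"
        using arg_cong[OF G, of "\<lambda>A. A $ m"] by (simp add: fps_mult_nth)
      finally show ?thesis using Suc by (simp del: of_nat_Suc)
    qed
  qed
qed

text \<open>
  This is the functional equation of the exponential: the generating series at \<open>z + w\<close> is the product
  of those at \<open>z\<close> and \<open>w\<close>, because both solve the same differential equation.
\<close>

lemma translation_formula:
  "binomial_seq c n (z + w) = (\<Sum>i\<le>n. binomial_seq c i z * binomial_seq c (n - i) w)"
proof -
  define E where "E z = Abs_fps (\<lambda>n. binomial_seq c n z)" for z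
  define H where "H z = Abs_fps (\<lambda>k. exponent_deriv c k z)" for z
  have ode: "fps_deriv (E z) = H z * E z" for z
    by (rule fps_ext)
      (simp add: E_def H_def fps_mult_nth atLeast0AtMost del: of_nat_Suc)
  have "H (z + w) = H z + H w"
    by (rule fps_ext) (simp add: H_def exponent_deriv_def algebra_simps)
  then have "fps_deriv (E z * E w) = H (z + w) * (E z * E w)"
    by (simp add: ode algebra_simps)
  then have "E (z + w) = E z * E w"
    by (rule fps_linear_ode_unique[OF ode]) (simp add: E_def)
  then have "E (z + w) $ n = (E z * E w) $ n" by simp
  then show ?thesis by (simp add: E_def fps_mult_nth atLeast0AtMost)
qed

section \<open>The submodule spanned by these polynomials\<close>

lemma sum_fun_apply:
  fixes f :: "'i \<Rightarrow> 'a \<Rightarrow> 'b :: comm_monoid_add"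
  shows "(\<Sum>i\<in>I. f i) x = (\<Sum>i\<in>I. f i x)"
  by (induction I rule: infinite_finite_induct) auto

lemma submodule_span_binomial_seq: "submodule (scale_fun.span (range (binomial_seq c)))"
  unfolding submodule_def
proof (intro conjI ballI allI)
  let ?M = "scale_fun.span (range (binomial_seq c))"
  show "?M \<subseteq> polys2"
    by (rule scale_fun.span_minimal) (auto simp: binomial_seq_polys2 subspace_polys2)
  show "scale_fun.subspace ?M" by (rule scale_fun.subspace_span)
  fix f w
  assume "f \<in> ?M"
  then show "(\<lambda>z. f (z + w)) \<in> ?M"
  proof (induction rule: scale_fun.span_induct_alt)
    case base
    then show ?case using scale_fun.span_zero by (simp add: zero_fun_def)
  next
    case (step a f g)
    obtain n where n: "f = binomial_seq c n" using step(1) by blast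
    have "(\<lambda>z. f (z + w))
        = (\<Sum>i\<le>n. scale_fun (binomial_seq c (n - i) w) (binomial_seq c i))"
      by (auto simp: n translation_formula scale_fun_def fun_eq_iff sum_fun_apply mult.commute
        intro!: sum.cong)
    also have "\<dots> \<in> ?M"
      by (intro scale_fun.span_sum scale_fun.span_scale scale_fun.span_base) auto
    finally have "scale_fun a (\<lambda>z. f (z + w)) + (\<lambda>z. g (z + w)) \<in> ?M"
      using step(2) by (intro scale_fun.span_add scale_fun.span_scale)
    moreover have "(\<lambda>z. (scale_fun a f + g) (z + w))
        = scale_fun a (\<lambda>z. f (z + w)) + (\<lambda>z. g (z + w))"
      by (simp add: fun_eq_iff scale_fun_def)
    ultimately show ?case by (simp only:)
  qed
qed

lemma span_binomial_seq_explicit: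
  assumes "f \<in> scale_fun.span (range (binomial_seq c))"
  shows "\<exists>N a. \<forall>z. f z = (\<Sum>i\<le>N. a i * binomial_seq c i z)"
  using assms
proof (induction rule: scale_fun.span_induct_alt)
  case base
  show ?case by (rule exI[of _ 0], rule exI[of _ "\<lambda>_. 0"]) simp
next
  case (step b f g)
  obtain n where n: "f = binomial_seq c n" using step(1) by blast
  obtain N a where g: "\<And>z. g z = (\<Sum>i\<le>N. a i * binomial_seq c i z)" using step(2) by blast
  define a' where "a' i = (if i = n then b else 0) + (if i \<le> N then a i else 0)" for i
  have "(scale_fun b f + g) z = (\<Sum>i\<le>max N n. a' i * binomial_seq c i z)" for z
  proof -
    have "(\<Sum>i\<le>max N n. a' i * binomial_seq c i z)
        = (\<Sum>i\<le>max N n. if i = n then b * binomial_seq c i z else 0)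
          + (\<Sum>i\<le>max N n. if i \<in> {..N} then a i * binomial_seq c i z else 0)"
      unfolding sum.distrib[symmetric]
      by (rule sum.cong) (auto simp: a'_def algebra_simps)
    also have "\<dots> = b * binomial_seq c n z + (\<Sum>i\<in>{..max N n} \<inter> {..N}. a i * binomial_seq c i z)"
      by (subst sum.inter_restrict) auto
    also have "{..max N n} \<inter> {..N} = {..N}" by auto
    finally show ?thesis by (simp add: n g scale_fun_def)
  qed
  then show ?case by blast
qed

text \<open>
  For \<open>x = 0\<close> the \<open>e\<^sub>n\<close> become \<open>y\<^sup>n/n!\<close>, which are linearly independent, whereas \<open>x\<close> becomes \<open>0\<close>.
\<close>

lemma fst_notin_span_binomial_seq: "fst \<notin> scale_fun.span (range (binomial_seq c))"
proof
  assume "fst \<in> scale_fun.span (range (binomial_seq c))"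
  then obtain N a where a: "\<And>z. fst z = (\<Sum>i\<le>N. a i * binomial_seq c i z)"
    using span_binomial_seq_explicit by blast
  have "(\<Sum>i\<le>N. (a i / fact i) * y ^ i) = 0" for y
    using a[of "(0, y)"] by (simp add: binomial_seq_axis)
  then have "\<forall>i\<le>N. a i / fact i = 0"
    using polyfun_eq_0[of "\<lambda>i. a i / fact i" N] by blast
  then have "fst (1 :: complex, 0 :: complex) = 0"
    by (subst a) (auto intro!: sum.neutral)
  then show False by simp
qed

section \<open>Rapidly growing coefficients\<close>

text \<open>
  The coefficients can be chosen recursively, since the polynomial to be dominated depends only on the
  previous ones and is bounded on the compact ball. The factor \<open>of_nat (Suc n) / c n\<close> makes the
  coefficient of \<open>x\<close> in \<open>binomial_seq_top_coefficient\<close> equal to \<open>1\<close>.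
\<close>

lemma fast_coefficients:
  "\<exists>c. \<forall>n. c n \<noteq> 0 \<and>
    (\<forall>z\<in>cball 0 (real n).
       norm (of_nat (Suc n) / c n * binomial_seq (c(n := 0)) (Suc n) z) \<le> 1 / real (Suc n))"
proof -
  define P where "P c n r \<longleftrightarrow> r \<noteq> 0 \<and>
    (\<forall>z\<in>cball 0 (real n).
       norm (of_nat (Suc n) / r * binomial_seq (c(n := 0)) (Suc n) z) \<le> 1 / real (Suc n))"
    for c :: "nat \<Rightarrow> complex" and n r
  have "\<exists>c. \<forall>n. P c n (c n)"
  proof (rule dependent_wellorder_choice)
    fix n r and c d :: "nat \<Rightarrow> complex"
    assume "\<And>k. k < n \<Longrightarrow> c k = d k"
    then have "binomial_seq (c(n := 0)) (Suc n) z = binomial_seq (d(n := 0)) (Suc n) z" for z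
      by (intro binomial_seq_cong) auto
    then show "P c n r = P d n r" unfolding P_def by (simp only:)
  next
    fix n and c :: "nat \<Rightarrow> complex"
    let ?g = "binomial_seq (c(n := 0)) (Suc n)"
    have "bounded (?g ` cball 0 (real n))"
      by (intro compact_imp_bounded compact_continuous_image continuous_on_binomial_seq
        compact_cball)
    then obtain B where B: "B > 0" "\<And>z. z \<in> cball 0 (real n) \<Longrightarrow> norm (?g z) \<le> B"
      unfolding bounded_pos by blast
    define r where "r = complex_of_real (real (Suc n) ^ 2 * B)"
    have norm_r: "norm r = real (Suc n) ^ 2 * B"
      unfolding r_def norm_of_real using B(1) by simp
    have "r \<noteq> 0" using norm_r B(1) by auto
    moreover have "norm (of_nat (Suc n) / r * ?g z) \<le> 1 / real (Suc n)"
      if "z \<in> cball 0 (real n)" for z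
    proof -
      have "norm (of_nat (Suc n) / r * ?g z) = real (Suc n) / (real (Suc n) ^ 2 * B) * norm (?g z)"
        by (simp only: norm_mult norm_divide norm_r norm_of_nat)
      also have "\<dots> \<le> real (Suc n) / (real (Suc n) ^ 2 * B) * B"
        using B that by (intro mult_left_mono) auto
      also have "\<dots> = 1 / real (Suc n)"
        using B(1) by (simp add: power2_eq_square del: of_nat_Suc)
      finally show ?thesis .
    qed
    ultimately show "\<exists>r. P c n r" unfolding P_def by blast
  qed
  then show ?thesis unfolding P_def .
qed

lemma in_closure_of_uniform_limit:
  assumes f: "f \<in> polys2" and M: "M \<subseteq> polys2"
    and g: "\<And>n. g n \<in> M"
      "\<And>n z. z \<in> cball 0 (real n) \<Longrightarrow> dist (g n z) (f z) \<le> 1 / real (Suc n)"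
  shows "f \<in> compact_conv_topology closure_of M"
  unfolding in_closure_of topspace_compact_conv_topology
proof (intro conjI allI impI f)
  fix U
  assume "f \<in> U \<and> openin compact_conv_topology U"
  then obtain K e where K: "compact K" "e > 0"
      "{h \<in> polys2. \<forall>z\<in>K. dist (h z) (f z) < e} \<subseteq> U"
    unfolding openin_compact_conv_topology by meson
  obtain R where R: "\<And>z. z \<in> K \<Longrightarrow> norm z \<le> R"
    using compact_imp_bounded[OF K(1)] unfolding bounded_iff by blast
  obtain n where n: "max R (1 / e) < real n" using reals_Archimedean2 by blast
  have "1 / real (Suc n) < e"
    using n K(2) by (simp add: field_simps)
  moreover have "z \<in> cball 0 (real n)" if "z \<in> K" for z
    using R[OF that] n by simp
  ultimately have "\<forall>z\<in>K. dist (g n z) (f z) < e"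
    using g(2) by (meson le_less_trans)
  then show "\<exists>h. h \<in> M \<and> h \<in> U"
    using K(3) g(1)[of n] M by blast
qed

theorem theorem25:
  "\<exists>M. submodule M \<and> fst \<in> compact_conv_topology closure_of M \<and> fst \<notin> M"
proof -
  obtain c where c: "\<And>n. c n \<noteq> 0"
      "\<And>n z. z \<in> cball 0 (real n) \<Longrightarrow>
        norm (of_nat (Suc n) / c n * binomial_seq (c(n := 0)) (Suc n) z) \<le> 1 / real (Suc n)"
    using fast_coefficients by meson
  let ?M = "scale_fun.span (range (binomial_seq c))"
  define g where "g n = scale_fun (of_nat (Suc n) / c n) (binomial_seq c (Suc n))" for n
  have g_eq: "g n z = fst z + of_nat (Suc n) / c n * binomial_seq (c(n := 0)) (Suc n) z" for n z
    using c(1)[of n] unfolding g_def scale_fun_def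
    by (subst binomial_seq_top_coefficient)
      (simp add: distrib_left del: of_nat_Suc binomial_seq.simps)
  have "fst \<in> compact_conv_topology closure_of ?M"
  proof (rule in_closure_of_uniform_limit[where g = g])
    show "g n \<in> ?M" for n
      unfolding g_def by (intro scale_fun.span_scale scale_fun.span_base) auto
    show "dist (g n z) (fst z) \<le> 1 / real (Suc n)" if "z \<in> cball 0 (real n)" for n z
      using c(2)[OF that] by (simp only: g_eq dist_norm add_diff_cancel_left')
  qed (use polys2_fst submodule_span_binomial_seq[of c] in \<open>auto simp: submodule_def\<close>)
  then show ?thesis
    using submodule_span_binomial_seq fst_notin_span_binomial_seq by blast
qed

end
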